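(* Let $\lambda>0$. For each $t\in\mathbb R^m$, let $\sigma(t)$ be an operator on $\mathcal F_\lambda$. Then the equation $$\pi(t,h)=\rho_\lambda(h)\,\sigma(t),\qquad t\in\mathbb R^m,\ h\in H_n,$$ defines a unitary representation $\pi$ of $G$ on $\mathcal F_\lambda$ if and only if there exists a unitary character $\chi$ of $\mathbb R^m$ such that $$(\sigma(t)f)(z)=\chi(t)\,f(t^{-1}\cdot z)$$ for each $t\in\mathbb R^m$, $f\in\mathcal F_\lambda$ and $z\in\mathbb C^n$. In this case, we have $$(\pi(t,z_0,c_0)f)(z)=\chi(t)\exp\left(i\lambda c_0+\tfrac{\lambda}{2}\bar z_0 z-\tfrac{\lambda}{4}|z_0|^2\right)f\bigl(t^{-1}\cdot(z-z_0)\bigr)$$ for each $t\in\mathbb R^m$, $f\in\mathcal F_\lambda$, $z,z_0\in\mathbb C^n$ and $c_0\in\mathbb R$.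
   Context: Fix integers $n,m\ge 1$. For $z,w\in\mathbb C^n$ put $zw:=\sum_{k=1}^n z_kw_k$ (bilinear), $|z|^2=z\bar z$, and $\omega((z,w),(z',w')):=\tfrac i2(zw'-z'w)$. The Heisenberg group is $H_n=\{(z,c):z\in\mathbb C^n,c\in\mathbb R\}$ with $(z,c)\cdot(z',c')=(z+z',c+c'+\tfrac12\omega((z,\bar z),(z',\bar z')))$. Let $\alpha_1,\dots,\alpha_n$ be linear forms on $\mathbb R^m$; $\mathbb R^m$ acts on $\mathbb C^n$ by $t\cdot z=(e^{i\alpha_1(t)}z_1,\dots,e^{i\alpha_n(t)}z_n)$; $t^{-1}$ means $-t$. It acts on $H_n$ by $t\cdot(z,c)=(t\cdot z,c)$. The generalized diamond group $G=\mathbb R^m\rtimes H_n$ is $\mathbb R^m\times\mathbb C^n\times\mathbb R$ with $(t,z,c)\cdot(t',z',c')=(t+t',\,z+t\cdot z',\,c+c'+\tfrac12\omega((z,\bar z),(t\cdot z',\overline{t\cdot z'})))$; elements are written $(t,h)$ with $h=(z,c)\in H_n$. $\mathcal F_\lambda$ is the Hilbert (Fock) space of holomorphic $f$ on $\mathbb C^n$ with $\|f\|_\lambda^2=\int_{\mathbb C^n}|f(z)|^2e^{-\lambda|z|^2/2}d\mu_\lambda(z)<\infty$, where $d\mu_\lambda=(2\pi)^{-n}\lambda^n\,dx\,dy$, $z=x+iy$. The Bargmann-Fock representation of $H_n$ on $\mathcal F_\lambda$ is $(\rho_\lambda(z_0,c_0)f)(z)=\exp(i\lambda c_0+\tfrac\lambda2\bar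 z_0z-\tfrac\lambda4|z_0|^2)f(z-z_0)$. Unitary representations and unitary characters are (strongly) continuous, as usual. *)

theory Defs
  imports "HOL-Analysis.Analysis"
begin

definition cdot :: "complex ^ 'n \<Rightarrow> complex ^ 'n \<Rightarrow> complex" where
  "cdot z w = (\<Sum>k\<in>UNIV. z $ k * w $ k)"

definition vcnj :: "complex ^ 'n \<Rightarrow> complex ^ 'n" where
  "vcnj z = (\<chi> k. cnj (z $ k))"

text \<open>The squared modulus \<open>z \<cdot> cnj z\<close> is the square of the library norm on \<open>complex ^ 'n\<close>,
  which is used throughout.\<close>

lemma cdot_vcnj_self: "cdot z (vcnj z) = complex_of_real ((norm z)\<^sup>2)"
  by (simp add: cdot_def vcnj_def norm_vec_def L2_set_def sum_nonneg complex_norm_square[symmetric])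

definition omega :: "(complex ^ 'n) \<times> (complex ^ 'n) \<Rightarrow> (complex ^ 'n) \<times> (complex ^ 'n) \<Rightarrow> complex" where
  "omega = (\<lambda>(z, w) (z', w'). \<i> / 2 * (cdot z w' - cdot z' w))"

lemma omega_real: "omega (z, vcnj z) (z', vcnj z') \<in> \<real>"
proof -
  have "cdot z' (vcnj z) = cnj (cdot z (vcnj z'))"
    by (simp add: cdot_def vcnj_def mult.commute)
  then show ?thesis
    by (simp add: omega_def complex_is_Real_iff)
qed

text \<open>By \<open>omega_real\<close>, taking the real part below only changes the type.\<close>

definition heis_mult ::
  "(complex ^ 'n) \<times> real \<Rightarrow> (complex ^ 'n) \<times> real \<Rightarrow> (complex ^ 'n) \<times> real" where
  "heis_mult = (\<lambda>(z, c) (z', c').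
     (z + z', c + c' + 1 / 2 * Re (omega (z, vcnj z) (z', vcnj z'))))"

definition act :: "('n \<Rightarrow> real ^ 'm \<Rightarrow> real) \<Rightarrow> real ^ 'm \<Rightarrow> complex ^ 'n \<Rightarrow> complex ^ 'n" where
  "act \<alpha> t z = (\<chi> k. exp (\<i> * complex_of_real (\<alpha> k t)) * z $ k)"

text \<open>The semidirect product; an element \<open>(t, h)\<close> with \<open>h = (z, c)\<close> is the triple \<open>(t, z, c)\<close>.\<close>

definition diamond_mult :: "('n \<Rightarrow> real ^ 'm \<Rightarrow> real) \<Rightarrow>
    (real ^ 'm) \<times> (complex ^ 'n) \<times> real \<Rightarrow> (real ^ 'm) \<times> (complex ^ 'n) \<times> real \<Rightarrow>
    (real ^ 'm) \<times> (complex ^ 'n) \<times> real" where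
  "diamond_mult \<alpha> = (\<lambda>(t, z, c) (t', z', c'). (t + t', heis_mult (z, c) (act \<alpha> t z', c')))"

definition entire_Cn :: "(complex ^ 'n \<Rightarrow> complex) \<Rightarrow> bool" where
  "entire_Cn f \<longleftrightarrow> (\<forall>z. \<exists>D. (f has_derivative D) (at z) \<and> (\<forall>c v. D (c *s v) = c * D v))"

definition fock_measure :: "real \<Rightarrow> (complex ^ 'n) measure" where
  "fock_measure lam = density lborel (\<lambda>_. ennreal (lam ^ CARD('n) / (2 * pi) ^ CARD('n)))"

definition fock_space :: "real \<Rightarrow> (complex ^ 'n \<Rightarrow> complex) set" where
  "fock_space lam = {f. entire_Cn f \<and>
     integrable (fock_measure lam) (\<lambda>z. (cmod (f z))\<^sup>2 * exp (- lam * (norm z)\<^sup>2 / 2))}"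

definition fock_inner :: "real \<Rightarrow> (complex ^ 'n \<Rightarrow> complex) \<Rightarrow> (complex ^ 'n \<Rightarrow> complex) \<Rightarrow> complex" where
  "fock_inner lam f g =
     (LINT z|fock_measure lam. f z * cnj (g z) * complex_of_real (exp (- lam * (norm z)\<^sup>2 / 2)))"

definition fock_norm :: "real \<Rightarrow> (complex ^ 'n \<Rightarrow> complex) \<Rightarrow> real" where
  "fock_norm lam f =
     sqrt (LINT z|fock_measure lam. (cmod (f z))\<^sup>2 * exp (- lam * (norm z)\<^sup>2 / 2))"

text \<open>An operator is a linear map of the Fock space into itself, represented by a total function
  on \<open>complex ^ 'n \<Rightarrow> complex\<close> of which only the values on \<open>fock_space lam\<close> matter.
  Boundedness is not required.\<close>

definition fock_operator ::
  "real \<Rightarrow> ((complex ^ 'n \<Rightarrow> complex) \<Rightarrow> complex ^ 'n \<Rightarrow> complex) \<Rightarrow> bool" where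
  "fock_operator lam T \<longleftrightarrow>
     (\<forall>f\<in>fock_space lam. T f \<in> fock_space lam) \<and>
     (\<forall>f\<in>fock_space lam. \<forall>g\<in>fock_space lam. T (\<lambda>z. f z + g z) = (\<lambda>z. T f z + T g z)) \<and>
     (\<forall>a. \<forall>f\<in>fock_space lam. T (\<lambda>z. a * f z) = (\<lambda>z. a * T f z))"

definition fock_unitary ::
  "real \<Rightarrow> ((complex ^ 'n \<Rightarrow> complex) \<Rightarrow> complex ^ 'n \<Rightarrow> complex) \<Rightarrow> bool" where
  "fock_unitary lam U \<longleftrightarrow>
     fock_operator lam U \<and> U ` fock_space lam = fock_space lam \<and>
     (\<forall>f\<in>fock_space lam. \<forall>g\<in>fock_space lam. fock_inner lam (U f) (U g) = fock_inner lam f g)"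

text \<open>Unitary representations of a topological group, given by its multiplication, on the Fock space:
  strongly continuous homomorphisms into the unitary group.\<close>

definition unitary_rep :: "('g::topological_space \<Rightarrow> 'g \<Rightarrow> 'g) \<Rightarrow> real \<Rightarrow>
    ('g \<Rightarrow> (complex ^ 'n \<Rightarrow> complex) \<Rightarrow> complex ^ 'n \<Rightarrow> complex) \<Rightarrow> bool" where
  "unitary_rep mul lam \<pi> \<longleftrightarrow>
     (\<forall>x. fock_unitary lam (\<pi> x)) \<and>
     (\<forall>x y. \<forall>f\<in>fock_space lam. \<pi> (mul x y) f = \<pi> x (\<pi> y f)) \<and>
     (\<forall>f\<in>fock_space lam. \<forall>x. ((\<lambda>y. fock_norm lam (\<lambda>z. \<pi> y f z - \<pi> x f z)) \<longlongrightarrow> 0) (at x))"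

definition unitary_character :: "(real ^ 'm \<Rightarrow> complex) \<Rightarrow> bool" where
  "unitary_character chi \<longleftrightarrow>
     continuous_on UNIV chi \<and> (\<forall>t. cmod (chi t) = 1) \<and> (\<forall>s t. chi (s + t) = chi s * chi t)"

definition bargmann_fock :: "real \<Rightarrow> (complex ^ 'n) \<times> real \<Rightarrow>
    (complex ^ 'n \<Rightarrow> complex) \<Rightarrow> complex ^ 'n \<Rightarrow> complex" where
  "bargmann_fock lam = (\<lambda>(z0, c0) f z.
     exp (\<i> * complex_of_real (lam * c0) + complex_of_real (lam / 2) * cdot (vcnj z0) z
          - complex_of_real (lam / 4 * (norm z0)\<^sup>2)) * f (z - z0))"

end

theory Submission
  imports Defs "HOL-Probability.Distributions" "HOL-Complex_Analysis.Cauchy_Integral_Formula"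
begin

text \<open>Averaging over the rotations \<open>z \<mapsto> e\<^sup>i\<^sup>s z\<close> and Cauchy's formula on complex lines give
  \<open>\<langle>f, 1\<rangle> = f 0 \<langle>1, 1\<rangle>\<close>, and translating by \<open>\<rho>(w, 0)\<close> gives the reproducing property, with the coherent
  states \<open>\<rho>(w, 0) 1\<close> as kernel. If \<open>\<pi>\<close> is a representation, then \<open>\<sigma> t\<close> intertwines \<open>\<rho>(h)\<close> and
  \<open>\<rho>(t h)\<close>. Evaluating \<open>\<langle>\<sigma> t 1, \<rho>(v, 0) 1\<rangle>\<close> in two ways shows that \<open>\<sigma> t 1\<close> is both entire and
  conjugate-entire, hence a constant \<open>chi t\<close>. This replaces Schur's lemma: \<open>\<sigma> t\<close> maps each
  coherent state to \<open>chi t\<close> times the rotated one, and unitarity with the reproducing property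
  determines \<open>\<sigma> t f\<close> for every \<open>f\<close>. Conversely, strong continuity follows from pointwise
  convergence and equality of norms, by the parallelogram law and
  Scheffe's lemma for \<open>|F n + G|\<^sup>2\<close>.\<close>

section \<open>Invariant measures and Gaussians\<close>

lemma nn_integral_lborel_translate:
  fixes f :: "'a::euclidean_space \<Rightarrow> ennreal"
  assumes [measurable]: "f \<in> borel_measurable borel"
  shows "(\<integral>\<^sup>+x. f (x + a) \<partial>lborel) = (\<integral>\<^sup>+x. f x \<partial>lborel)"
proof -
  have "(\<integral>\<^sup>+x. f x \<partial>lborel) = (\<integral>\<^sup>+x. f x \<partial>distr lborel borel ((+) a))"
    by (simp add: lborel_distr_plus)
  also have "\<dots> = (\<integral>\<^sup>+x. f (x + a) \<partial>lborel)"
    by (subst nn_integral_distr) (simp_all add: add.commute)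
  finally show ?thesis ..
qed

text \<open>Uniqueness of Haar measure in disguise: with \<open>g\<close> the indicator of a ball, Tonelli and
  translation invariance turn \<open>\<integral>f \<integral>g\<close> into \<open>\<integral>(f \<circ> U) \<integral>g\<close>.\<close>

lemma nn_integral_lborel_orthogonal:
  fixes U :: "'a::euclidean_space \<Rightarrow> 'a"
  assumes U: "orthogonal_transformation U" and f[measurable]: "f \<in> borel_measurable borel"
  shows "(\<integral>\<^sup>+x. f (U x) \<partial>lborel) = (\<integral>\<^sup>+x. f x \<partial>lborel)"
proof -
  have linU: "linear U" and normU: "\<And>x. norm (U x) = norm x"
    using U by (auto simp: orthogonal_transformation)
  have [measurable]: "U \<in> borel \<rightarrow>\<^sub>M borel"
    using linU by (simp add: borel_measurable_continuous_onI linear_continuous_on linear_conv_bounded_linear)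
  obtain V where V: "\<And>x. U (V x) = x"
    using orthogonal_transformation_surj[OF U] by (metis surjD)
  \<comment> \<open>The auxiliary function must be unchanged by \<open>U\<close> and by negation,
    and its integral must be positive and finite so that it can be cancelled at the end.\<close>
  define g :: "'a \<Rightarrow> ennreal" where "g = indicator (cball 0 1)"
  have [measurable]: "g \<in> borel_measurable borel" 
    unfolding g_def by (intro borel_measurable_indicator borel_closed closed_cball)
  have gsym: "g (U x) = g x" "g (- x) = g x" for x
    by (simp_all add: g_def indicator_def normU)
  define c where "c = (\<integral>\<^sup>+x. g x \<partial>lborel)"
  have c: "c \<noteq> 0" "c \<noteq> top"
    using unit_ball_vol_pos[of "real DIM('a)"]
    by (simp_all add: c_def g_def emeasure_cball less_imp_neq[THEN not_sym])
  \<comment> \<open>Since \<open>a = U (V a)\<close>, shifting the argument of \<open>h\<close> by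
    \<open>a\<close> amounts to translating the integration variable by \<open>V a\<close>.\<close>
  have shift: "(\<integral>\<^sup>+x. h (U x + a) \<partial>lborel) = (\<integral>\<^sup>+x. h (U x) \<partial>lborel)"
    if [measurable]: "h \<in> borel_measurable borel" for h :: "'a \<Rightarrow> ennreal" and a
    using nn_integral_lborel_translate[of "\<lambda>x. h (U x)" "V a"] by (simp add: V linear_add[OF linU])
  have gint: "(\<integral>\<^sup>+x. g (y - x) \<partial>lborel) = c" for y
    using nn_integral_lborel_translate[of g "- y"] gsym(2)[of "x - y" for x] by (simp add: c_def)
  have cU: "(\<integral>\<^sup>+y. g (U y) \<partial>lborel) = c" by (simp add: c_def gsym)
  have "(\<integral>\<^sup>+x. f x \<partial>lborel) * c = (\<integral>\<^sup>+y. \<integral>\<^sup>+x. f x * g (U y) \<partial>lborel \<partial>lborel)"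
    by (simp add: nn_integral_multc nn_integral_cmult cU)
  \<comment> \<open>For fixed \<open>y\<close>, \<open>x\<close> is translated by
    \<open>U y\<close>. After the integrals are exchanged, \<open>shift\<close> replaces
    \<open>U y\<close> by \<open>U y - x\<close>, which moves \<open>x\<close> from the argument of
    \<open>f\<close> to that of \<open>g\<close>.\<close>
  also have "\<dots> = (\<integral>\<^sup>+y. \<integral>\<^sup>+x. f (x + U y) * g (U y) \<partial>lborel \<partial>lborel)"
    by (simp add: nn_integral_multc nn_integral_lborel_translate)
  also have "\<dots> = (\<integral>\<^sup>+x. \<integral>\<^sup>+y. f (x + U y) * g (U y) \<partial>lborel \<partial>lborel)"
    by (rule lborel_pair.Fubini') simp
  also have "\<dots> = (\<integral>\<^sup>+x. \<integral>\<^sup>+y. f (U y) * g (U y - x) \<partial>lborel \<partial>lborel)"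
  proof (rule nn_integral_cong)
    fix x :: 'a
    show "(\<integral>\<^sup>+y. f (x + U y) * g (U y) \<partial>lborel) = (\<integral>\<^sup>+y. f (U y) * g (U y - x) \<partial>lborel)"
      using shift[of "\<lambda>z. f z * g (z - x)" x] by (simp add: add.commute)
  qed
  also have "\<dots> = (\<integral>\<^sup>+y. \<integral>\<^sup>+x. f (U y) * g (U y - x) \<partial>lborel \<partial>lborel)"
    by (rule lborel_pair.Fubini') simp
  also have "\<dots> = (\<integral>\<^sup>+x. f (U x) \<partial>lborel) * c"
    by (simp add: nn_integral_cmult gint nn_integral_multc)
  finally show ?thesis
    using c by (simp add: ennreal_mult_cancel_left mult.commute[of _ c])
qed

lemma distr_lborel_orthogonal:
  fixes U :: "'a::euclidean_space \<Rightarrow> 'a"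
  assumes U: "orthogonal_transformation U"
  shows "distr lborel borel U = lborel"
proof (rule measure_eqI)
  have [measurable]: "U \<in> borel \<rightarrow>\<^sub>M borel"
    using U by (simp add: orthogonal_transformation borel_measurable_continuous_onI linear_continuous_on linear_conv_bounded_linear)
  fix A assume "A \<in> sets (distr lborel borel U)"
  then have A[measurable]: "A \<in> sets borel" by simp
  have "emeasure (distr lborel borel U) A = (\<integral>\<^sup>+x. indicator A x \<partial>distr lborel borel U)"
    by simp
  also have "\<dots> = (\<integral>\<^sup>+x. indicator A (U x) \<partial>lborel)"
    by (rule nn_integral_distr) simp_all
  also have "\<dots> = emeasure lborel A"
    by (subst nn_integral_lborel_orthogonal[OF U]) simp_all
  finally show "emeasure (distr lborel borel U) A = emeasure lborel A" .
qed simp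

section \<open>Invariance and Gaussian integrability for the Fock measure\<close>

lemma sets_fock_measure [measurable_cong, simp]: "sets (fock_measure lam) = sets borel"
  and space_fock_measure [simp]: "space (fock_measure lam) = UNIV"
  by (simp_all add: fock_measure_def)

lemma distr_fock_measure:
  fixes T :: "complex ^ 'a::finite \<Rightarrow> complex ^ 'a"
  assumes [measurable]: "T \<in> borel \<rightarrow>\<^sub>M borel" and T: "distr lborel borel T = lborel"
  shows "distr (fock_measure lam) borel T = fock_measure lam"
proof -
  have "fock_measure lam = density (distr lborel borel T) (\<lambda>_. ennreal (lam ^ CARD('a) / (2 * pi) ^ CARD('a)))"
    by (simp add: T fock_measure_def)
  also have "\<dots> = distr (fock_measure lam) borel T"
    by (subst density_distr) (simp_all add: fock_measure_def)
  finally show ?thesis ..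
qed

text \<open>Change of variables for an arbitrary map \<open>T\<close> preserving Lebesgue measure,
  so that one statement serves both the translations in \<open>bargmann_fock\<close> and the
  rotations. The integrability part is what gives membership in the Fock space.\<close>

lemma integral_fock_measure_invariant:
  fixes T :: "complex ^ 'n::finite \<Rightarrow> complex ^ 'n"
    and f :: "complex ^ 'n::finite \<Rightarrow> 'b::{banach, second_countable_topology}"
  assumes [measurable]: "T \<in> borel \<rightarrow>\<^sub>M borel" "f \<in> borel_measurable borel" and T: "distr lborel borel T = lborel"
  shows "(LINT z|fock_measure lam. f (T z)) = (LINT z|fock_measure lam. f z)"
    and "integrable (fock_measure lam) (\<lambda>z. f (T z)) \<longleftrightarrow> integrable (fock_measure lam) f"
proof -
  have [measurable]: "T \<in> fock_measure lam \<rightarrow>\<^sub>M borel" by simp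
  show "(LINT z|fock_measure lam. f (T z)) = (LINT z|fock_measure lam. f z)"
    using integral_distr[of T "fock_measure lam" borel f] by (simp add: distr_fock_measure[OF assms(1) T])
  show "integrable (fock_measure lam) (\<lambda>z. f (T z)) \<longleftrightarrow> integrable (fock_measure lam) f"
    using integrable_distr_eq[of T "fock_measure lam" borel f] by (simp add: distr_fock_measure[OF assms(1) T])
qed

lemma sigma_finite_fock_measure: "sigma_finite_measure (fock_measure lam)"
  unfolding fock_measure_def
  by (subst sigma_finite_measure.sigma_finite_iff_density_finite) (simp_all add: sigma_finite_lborel)

text \<open>The integrand factors over the orthonormal basis into one-dimensional Gaussians, each a
  multiple of a normal density.\<close>

lemma integrable_gaussian:
  assumes "a > 0"
  shows "integrable lborel (\<lambda>x::'a::euclidean_space. exp (- a * (norm x)\<^sup>2))"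
proof (rule integrableI_nonneg)
  have 1: "(\<integral>\<^sup>+x. ennreal (exp (- a * x\<^sup>2)) \<partial>lborel) < \<infinity>"
  proof -
    \<comment> \<open>The standard deviation for which
      \<open>exp (- x\<^sup>2 / (2 * s\<^sup>2))\<close> is
      \<open>exp (- a * x\<^sup>2)\<close>.\<close>
    define s where "s = sqrt (1 / (2 * a))"
    have s: "s > 0" "2 * s\<^sup>2 = 1 / a" using assms by (simp_all add: s_def)
    have "integrable lborel (\<lambda>x. sqrt (2 * pi * s\<^sup>2) * normal_density 0 s x)"
      using s by simp
    moreover have "(\<lambda>x. sqrt (2 * pi * s\<^sup>2) * normal_density 0 s x) = (\<lambda>x. exp (- a * x\<^sup>2))"
      using s assms by (auto simp: normal_density_def fun_eq_iff field_simps)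
    ultimately show ?thesis
      by (simp add: integrable_iff_bounded)
  qed
  have norm_sum: "(norm x)\<^sup>2 = (\<Sum>b\<in>Basis. (x \<bullet> b)\<^sup>2)" for x :: 'a
    unfolding power2_norm_eq_inner by (subst euclidean_inner) (simp add: power2_eq_square)
  have "(\<integral>\<^sup>+x. ennreal (exp (- a * (norm (x::'a))\<^sup>2)) \<partial>lborel)
      = (\<integral>\<^sup>+x. (\<Prod>b\<in>Basis. ennreal (exp (- a * ((x::'a) \<bullet> b)\<^sup>2))) \<partial>lborel)"
    by (simp add: prod_ennreal exp_sum[symmetric] sum_distrib_left[symmetric] sum_negf norm_sum)
  also have "\<dots> < \<infinity>"
    using 1 by (subst nn_integral_lborel_prod) (auto simp: power_less_top_ennreal)
  finally show "(\<integral>\<^sup>+x. ennreal (exp (- a * (norm (x::'a))\<^sup>2)) \<partial>lborel) < \<infinity>" .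
qed simp_all

lemma integrable_fock_gaussian:
  assumes "lam > 0"
  shows "integrable (fock_measure lam) (\<lambda>z::complex ^ 'n::finite. exp (- lam * (norm z)\<^sup>2 / 2))"
  unfolding fock_measure_def using assms integrable_gaussian[of "lam/2", where 'a="complex ^ 'n"]
  by (subst integrable_density) simp_all

section \<open>Entire functions and the mean value property\<close>

lemma entire_continuous: "entire_Cn f \<Longrightarrow> continuous_on UNIV f"
  by (metis entire_Cn_def continuous_at_imp_continuous_on has_derivative_continuous)

lemma entire_measurable: "entire_Cn f \<Longrightarrow> f \<in> borel_measurable borel"
  by (rule borel_measurable_continuous_onI[OF entire_continuous])

lemma entire_linear:
  assumes "linear L" "\<And>c v. L (c *s v) = c * L v"
  shows "entire_Cn L"
  unfolding entire_Cn_def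
  using assms linear_imp_has_derivative by blast

lemma entire_const: "entire_Cn (\<lambda>z. c)"
  unfolding entire_Cn_def by (intro allI exI[of _ "\<lambda>_. 0"]) (simp add: has_derivative_const)

lemma entire_add:
  assumes "entire_Cn f" "entire_Cn g"
  shows "entire_Cn (\<lambda>z. f z + g z)"
  unfolding entire_Cn_def
proof
  fix z
  obtain D E where "(f has_derivative D) (at z)" "\<And>c v. D (c *s v) = c * D v"
    "(g has_derivative E) (at z)" "\<And>c v. E (c *s v) = c * E v"
    using assms unfolding entire_Cn_def by metis
  then show "\<exists>D. ((\<lambda>z. f z + g z) has_derivative D) (at z) \<and> (\<forall>c v. D (c *s v) = c * D v)"
    by (intro exI[of _ "\<lambda>h. D h + E h"]) (simp add: has_derivative_add algebra_simps)
qed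

lemma entire_mult:
  assumes "entire_Cn f" "entire_Cn g"
  shows "entire_Cn (\<lambda>z. f z * g z)"
  unfolding entire_Cn_def
proof
  fix z
  obtain D E where "(f has_derivative D) (at z)" "\<And>c v. D (c *s v) = c * D v"
    "(g has_derivative E) (at z)" "\<And>c v. E (c *s v) = c * E v"
    using assms unfolding entire_Cn_def by metis
  then show "\<exists>D. ((\<lambda>z. f z * g z) has_derivative D) (at z) \<and> (\<forall>c v. D (c *s v) = c * D v)"
    by (intro exI[of _ "\<lambda>h. f z * E h + D h * g z"] conjI has_derivative_mult) (simp_all add: algebra_simps)
qed

lemma entire_exp:
  assumes "entire_Cn f"
  shows "entire_Cn (\<lambda>z. exp (f z))"
  unfolding entire_Cn_def
proof
  fix z
  obtain D where D: "(f has_derivative D) (at z)" "\<And>c v. D (c *s v) = c * D v"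
    using assms unfolding entire_Cn_def by metis
  have "((\<lambda>z. exp (f z)) has_derivative (\<lambda>h. exp (f z) * D h)) (at z)"
    using has_derivative_compose[OF D(1) DERIV_exp[of "f z", unfolded has_field_derivative_def]] .
  with D(2) show "\<exists>D. ((\<lambda>z. exp (f z)) has_derivative D) (at z) \<and> (\<forall>c v. D (c *s v) = c * D v)"
    by (intro exI[of _ "\<lambda>h. exp (f z) * D h"]) simp
qed

text \<open>By the chain rule the derivative is \<open>D\<close> after \<open>L\<close>, and complex
  homogeneity of \<open>L\<close> keeps it complex linear. Translations and the maps
  \<open>act \<alpha> t\<close> are both covered.\<close>

lemma entire_compose_affine:
  assumes f: "entire_Cn f" and L: "linear L" "\<And>c v. L (c *s v) = c *s L v"
  shows "entire_Cn (\<lambda>z. f (L z + b))"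
  unfolding entire_Cn_def
proof
  fix z
  obtain D where D: "(f has_derivative D) (at (L z + b))" "\<And>c v. D (c *s v) = c * D v"
    using f unfolding entire_Cn_def by metis
  have "((\<lambda>z. L z + b) has_derivative L) (at z)"
    using has_derivative_add[OF linear_imp_has_derivative[OF L(1)] has_derivative_const] by simp
  from has_derivative_compose[OF this D(1)] D(2) L(2)
  show "\<exists>D. ((\<lambda>z. f (L z + b)) has_derivative D) (at z) \<and> (\<forall>c v. D (c *s v) = c * D v)"
    by (intro exI[of _ "\<lambda>h. D (L h)"]) simp
qed

lemma entire_translate: "entire_Cn f \<Longrightarrow> entire_Cn (\<lambda>z. f (z - b))"
  using entire_compose_affine[of f "\<lambda>z. z" "- b"] by (simp add: linear_id[unfolded id_def])

section \<open>Circle averages on complex lines and evaluation at the origin\<close>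

lemma entire_restrict_line:
  assumes "entire_Cn f"
  shows "(\<lambda>\<zeta>. f (\<zeta> *s z)) holomorphic_on UNIV"
proof (unfold holomorphic_on_def, intro ballI)
  fix \<zeta> :: complex
  obtain D where D: "(f has_derivative D) (at (\<zeta> *s z))" "\<And>c v. D (c *s v) = c * D v"
    using assms unfolding entire_Cn_def by metis
  have "linear (\<lambda>\<zeta>::complex. \<zeta> *s z)"
    by (rule linearI) (simp_all add: vec_eq_iff algebra_simps)
  note has_derivative_compose[OF linear_imp_has_derivative[OF this] D(1)]
  moreover have "(\<lambda>h. D (h *s z)) = (*) (D z)" by (simp add: D(2) fun_eq_iff mult.commute)
  ultimately have "((\<lambda>\<zeta>. f (\<zeta> *s z)) has_derivative (*) (D z)) (at \<zeta>)" by simp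
  then show "(\<lambda>\<zeta>. f (\<zeta> *s z)) field_differentiable at \<zeta> within UNIV"
    unfolding field_differentiable_def has_field_derivative_def by auto
qed

text \<open>Cauchy's integral formula at the centre of the unit circle, written as a Lebesgue
  integral with an indicator so that Fubini's theorem can be applied to it.\<close>

lemma holomorphic_circle_mean:
  assumes h: "h holomorphic_on UNIV"
  shows "(LINT s|lborel. indicator {0..1} s *\<^sub>R h (exp (2 * of_real pi * \<i> * of_real s))) = h 0"
proof -
  let ?e = "\<lambda>s::real. exp (2 * of_real pi * \<i> * of_real s)"
  have ch: "continuous_on A h" for A
    using h holomorphic_on_imp_continuous_on continuous_on_subset by blast
  have "((\<lambda>u. h u / (u - 0)) has_contour_integral (2 * of_real pi * \<i> * h 0)) (circlepath 0 1)"
    by (rule Cauchy_integral_circlepath[OF ch]) (use h holomorphic_on_subset in auto)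
  then have "((\<lambda>s. 2 * of_real pi * \<i> * h (?e s)) has_integral (2 * of_real pi * \<i> * h 0)) {0..1}"
    by (simp add: has_contour_integral vector_derivative_circlepath) (simp add: circlepath mult_ac)
  from has_integral_mult_right[OF this, of "1 / (2 * of_real pi * \<i>)"]
  have "((\<lambda>s. h (?e s)) has_integral h 0) {0..1}" by simp
  moreover have "set_integrable lborel {0..1} (\<lambda>s. h (?e s))"
    by (intro borel_integrable_atLeastAtMost' continuous_on_compose2[OF ch[of UNIV]] continuous_intros) auto
  ultimately show ?thesis
    using set_borel_integral_eq_integral(2) integral_unique unfolding set_lebesgue_integral_def by metis
qed

lemma orthogonal_scalar:
  assumes "cmod u = 1"
  shows "orthogonal_transformation (\<lambda>z::complex ^ 'n::finite. u *s z)"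
  unfolding orthogonal_transformation
proof
  show "linear (\<lambda>z::complex ^ 'n. u *s z)"
    by (rule linearI) (simp_all add: vec_eq_iff algebra_simps)
  show "\<forall>v. norm (u *s v) = norm (v :: complex ^ 'n)"
    using assms by (simp add: norm_vec_def norm_mult)
qed

lemma fock_measurable [measurable_dest]: "f \<in> fock_space lam \<Longrightarrow> f \<in> borel_measurable borel"
  by (simp add: fock_space_def entire_measurable)

text \<open>The Gaussian weight has finite total mass, so square integrability implies
  integrability, by way of \<open>x \<le> 1 + x\<^sup>2\<close>.\<close>

lemma fock_integrable_weight:
  assumes "lam > 0" "f \<in> fock_space lam"
  shows "integrable (fock_measure lam) (\<lambda>z. f z * of_real (exp (- lam * (norm z)\<^sup>2 / 2)))"
proof (rule Bochner_Integration.integrable_bound)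
  let ?w = "\<lambda>z. exp (- lam * (norm z)\<^sup>2 / 2)"
  show "integrable (fock_measure lam) (\<lambda>z. ?w z + (cmod (f z))\<^sup>2 * ?w z)"
    using assms integrable_fock_gaussian by (intro Bochner_Integration.integrable_add) (auto simp: fock_space_def)
  have [measurable]: "f \<in> borel_measurable borel" using assms(2) by (rule fock_measurable)
  show "(\<lambda>z. f z * of_real (?w z)) \<in> borel_measurable (fock_measure lam)"
    by measurable
  have "x \<le> 1 + x\<^sup>2" for x :: real
    using zero_le_power2[of "x - 1/2"] by (simp add: power2_eq_square algebra_simps)
  then have "cmod (f z) * ?w z \<le> (1 + (cmod (f z))\<^sup>2) * ?w z" for z
    by (intro mult_right_mono) auto
  then show "AE z in fock_measure lam. norm (f z * of_real (?w z)) \<le> norm (?w z + (cmod (f z))\<^sup>2 * ?w z)"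
    by (intro AE_I2) (simp add: norm_mult algebra_simps)
qed

text \<open>The left side is the inner product of \<open>f\<close> with the constant 1. The weight
  is rotation invariant, so \<open>f z\<close> may be replaced by its average over the circle
  through \<open>z\<close>, which is \<open>f 0\<close>.\<close>

lemma fock_mean_value:
  fixes f :: "complex ^ 'n::finite \<Rightarrow> complex"
  assumes lam: "lam > 0" and f: "f \<in> fock_space lam"
  shows "(LINT z|fock_measure lam. f z * of_real (exp (- lam * (norm z)\<^sup>2 / 2)))
    = f 0 * of_real (LINT z|(fock_measure lam :: (complex ^ 'n) measure). exp (- lam * (norm z)\<^sup>2 / 2))"
proof -
  let ?M = "fock_measure lam :: (complex ^ 'n) measure"
  let ?w = "\<lambda>z::complex ^ 'n. exp (- lam * (norm z)\<^sup>2 / 2)"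
  let ?e = "\<lambda>s::real. exp (2 * of_real pi * \<i> * of_real s)"
  have ent: "entire_Cn f" using f by (simp add: fock_space_def)
  have [measurable]: "f \<in> borel_measurable borel" using f by (rule fock_measurable)
  interpret M: sigma_finite_measure ?M by (rule sigma_finite_fock_measure)
  interpret P: pair_sigma_finite lborel ?M ..
  \<comment> \<open>The rotated integrand, with \<open>s\<close> confined to an interval of length 1
    so that integration over \<open>s\<close> is averaging.\<close>
  define p where "p s z = indicator {0..1} s *\<^sub>R (f (?e s *s z) * of_real (?w z))" for s z
  have ortho: "orthogonal_transformation (\<lambda>z::complex ^ 'n. ?e s *s z)" for s
    by (rule orthogonal_scalar) simp
  have em: "(\<lambda>z::complex ^ 'n. ?e s *s z) \<in> borel \<rightarrow>\<^sub>M borel" for s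
    using ortho[of s] by (simp add: orthogonal_transformation borel_measurable_continuous_onI linear_continuous_on linear_conv_bounded_linear)
  have ne: "norm (?e s *s z) = norm z" for s and z :: "complex ^ 'n"
    using ortho[of s] by (simp add: orthogonal_transformation)
  have inv: "(LINT z|?M. f (?e s *s z) * of_real (?w z)) = (LINT z|?M. f z * of_real (?w z))"
            "integrable ?M (\<lambda>z. f (?e s *s z) * of_real (?w z))"
            "(LINT z|?M. cmod (f (?e s *s z)) * ?w z) = (LINT z|?M. cmod (f z) * ?w z)" for s
    using integral_fock_measure_invariant[OF em[of s] _ distr_lborel_orthogonal[OF ortho[of s]],
        where f = "\<lambda>z. f z * of_real (?w z)" and lam = lam]
      integral_fock_measure_invariant(1)[OF em[of s] _ distr_lborel_orthogonal[OF ortho[of s]],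
        where f = "\<lambda>z. cmod (f z) * ?w z" and lam = lam] fock_integrable_weight[OF lam f]
    by (simp_all add: ne)
  \<comment> \<open>Joint measurability comes from continuity of
    \<open>(s, z) \<mapsto> ?e s *s z\<close>. The integral of the absolute value over
    \<open>z\<close> is the same for all \<open>s\<close> in the unit interval, hence integrable in
    \<open>s\<close>.\<close>
  have intp: "integrable (lborel \<Otimes>\<^sub>M ?M) (case_prod p)"
  proof (rule P.Fubini_integrable)
    have "continuous_on UNIV (\<lambda>x::real \<times> (complex ^ 'n). ?e (fst x) *s snd x)"
      unfolding vector_scalar_mult_def by (intro continuous_intros)
    then have "(\<lambda>x::real \<times> (complex ^ 'n). ?e (fst x) *s snd x) \<in> borel \<rightarrow>\<^sub>M borel"
      by (rule borel_measurable_continuous_onI)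
    then have [measurable]: "(\<lambda>x::real \<times> (complex ^ 'n). ?e (fst x) *s snd x) \<in> borel \<Otimes>\<^sub>M borel \<rightarrow>\<^sub>M borel"
      by (simp add: borel_prod)
    have "(\<lambda>x. f (?e (fst x) *s snd x)) \<in> borel_measurable (borel \<Otimes>\<^sub>M borel)" by measurable
    then show "case_prod p \<in> borel_measurable (lborel \<Otimes>\<^sub>M ?M)"
      unfolding p_def case_prod_beta by measurable
    have "(\<lambda>s. LINT z|?M. norm (case_prod p (s, z)))
        = (\<lambda>s. indicator {0..1} s *\<^sub>R (LINT z|?M. cmod (f z) * ?w z))"
      using inv(3) by (auto simp: p_def norm_mult indicator_def)
    then show "integrable lborel (\<lambda>s. LINT z|?M. norm (case_prod p (s, z)))" by simp
    show "AE s in lborel. integrable ?M (\<lambda>z. case_prod p (s, z))"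
      using inv(2) by (auto simp: p_def indicator_def)
  qed
  have "(LINT z|?M. f z * of_real (?w z)) = (LINT s|lborel. indicator {0..1} (s::real) *\<^sub>R (LINT z|?M. f z * of_real (?w z)))"
    by (subst integral_scaleR_left) simp_all
  also have "\<dots> = (LINT s|lborel. LINT z|?M. p s z)"
    using inv(1) by (simp add: p_def)
  also have "\<dots> = (LINT z|?M. LINT s|lborel. p s z)"
    by (rule P.Fubini_integral[OF intp, symmetric])
  also have "\<dots> = (LINT z|?M. f 0 * of_real (?w z))"
  proof (rule Bochner_Integration.integral_cong[OF refl])
    fix z
    have "(LINT s|lborel. p s z) = (LINT s|lborel. (indicator {0..1} s *\<^sub>R f (?e s *s z)) * of_real (?w z))"
      by (simp only: p_def mult_scaleR_left)
    also have "\<dots> = f (0 *s z) * of_real (?w z)"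
      by (simp only: integral_mult_left_zero holomorphic_circle_mean[OF entire_restrict_line[OF ent, of z]])
    finally show "(LINT s|lborel. p s z) = f 0 * of_real (?w z)" by simp
  qed
  finally show ?thesis by simp
qed

text \<open>The derivative of the conjugate is the conjugate of the derivative \<open>D\<close>. If
  both are complex linear, then \<open>D\<close> vanishes.\<close>

lemma entire_cnj_imp_const:
  assumes "entire_Cn f" "entire_Cn (\<lambda>z. cnj (f z))"
  shows "f z = f 0"
proof -
  have "(f has_derivative (\<lambda>_. 0)) (at z)" for z
  proof -
    obtain D where D: "(f has_derivative D) (at z)" "\<And>c v. D (c *s v) = c * D v"
      using assms(1) unfolding entire_Cn_def by metis
    obtain E where E: "((\<lambda>z. cnj (f z)) has_derivative E) (at z)" "\<And>c v. E (c *s v) = c * E v"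
      using assms(2) unfolding entire_Cn_def by metis
    have "((\<lambda>z. cnj (f z)) has_derivative (\<lambda>h. cnj (D h))) (at z)"
      by (rule bounded_linear.has_derivative[OF bounded_linear_cnj D(1)])
    then have "E = (\<lambda>h. cnj (D h))" by (rule has_derivative_unique[OF E(1)])
    \<comment> \<open>The left side is also \<open>- \<i> * cnj (D v)\<close>, which forces
      \<open>D v = 0\<close>.\<close>
    then have "cnj (D (\<i> *s v)) = \<i> * cnj (D v)" for v using E(2) by metis
    then have "D = (\<lambda>_. 0)" by (auto simp: D(2) fun_eq_iff)
    with D(1) show ?thesis by simp
  qed
  then show ?thesis
    using has_derivative_zero_unique[OF convex_UNIV] by (metis UNIV_I)
qed

lemma borel_measurable_cnj [measurable]:
  "f \<in> borel_measurable M \<Longrightarrow> (\<lambda>x. cnj (f x)) \<in> borel_measurable M"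
  by (rule borel_measurable_continuous_on[OF continuous_on_cnj[OF continuous_on_id]])

section \<open>The Fock space and the Bargmann-Fock representation\<close>

text \<open>The two sides differ by the square of \<open>cmod (a - b)\<close>.\<close>

lemma cmod_add_sq_le: "(cmod (a + b))\<^sup>2 \<le> 2 * (cmod a)\<^sup>2 + 2 * (cmod b)\<^sup>2"
  using zero_le_power2[of "cmod (a - b)"]
  unfolding cmod_power2 by (simp add: power2_eq_square algebra_simps)

lemma fock_space_const:
  assumes "lam > 0"
  shows "(\<lambda>_::complex ^ 'n::finite. c) \<in> fock_space lam"
  using integrable_fock_gaussian[OF assms, where 'n = 'n] by (simp add: fock_space_def entire_const)

lemma fock_space_scale: "f \<in> fock_space lam \<Longrightarrow> (\<lambda>z. a * f z) \<in> fock_space lam"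
  by (simp add: fock_space_def entire_mult entire_const norm_mult power_mult_distrib mult.assoc)

lemma fock_space_add:
  assumes "f \<in> fock_space lam" "g \<in> fock_space lam"
  shows "(\<lambda>z. f z + g z) \<in> fock_space lam"
proof -
  have [measurable]: "f \<in> borel_measurable borel" "g \<in> borel_measurable borel"
    using assms fock_measurable by auto
  have "integrable (fock_measure lam) (\<lambda>z. (cmod (f z + g z))\<^sup>2 * exp (- lam * (norm z)\<^sup>2 / 2))"
  proof (rule Bochner_Integration.integrable_bound)
    show "integrable (fock_measure lam) (\<lambda>z. 2 * ((cmod (f z))\<^sup>2 * exp (- lam * (norm z)\<^sup>2 / 2))
        + 2 * ((cmod (g z))\<^sup>2 * exp (- lam * (norm z)\<^sup>2 / 2)))"
      using assms by (intro Bochner_Integration.integrable_add integrable_mult_right) (auto simp: fock_space_def)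
    show "AE z in fock_measure lam. norm ((cmod (f z + g z))\<^sup>2 * exp (- lam * (norm z)\<^sup>2 / 2))
      \<le> norm (2 * ((cmod (f z))\<^sup>2 * exp (- lam * (norm z)\<^sup>2 / 2))
        + 2 * ((cmod (g z))\<^sup>2 * exp (- lam * (norm z)\<^sup>2 / 2)))"
      using mult_right_mono[OF cmod_add_sq_le, of "exp (- lam * (norm z)\<^sup>2 / 2)" "f z" "g z" for z]
      by (intro AE_I2) (simp add: algebra_simps)
  qed measurable
  then show ?thesis using assms by (simp add: fock_space_def entire_add)
qed

lemma fock_space_diff:
  assumes "f \<in> fock_space lam" "g \<in> fock_space lam"
  shows "(\<lambda>z. f z - g z) \<in> fock_space lam"
  using fock_space_add[OF assms(1) fock_space_scale[OF assms(2), of "-1"]] by simp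

lemma fock_inner_commute: "fock_inner lam g f = cnj (fock_inner lam f g)"
  unfolding fock_inner_def by (subst Bochner_Integration.integral_cnj[symmetric]) (simp add: mult_ac)

lemma fock_inner_scale_left: "fock_inner lam (\<lambda>z. a * f z) g = a * fock_inner lam f g"
  by (simp add: fock_inner_def mult.assoc)

lemma fock_inner_scale_right: "fock_inner lam f (\<lambda>z. a * g z) = cnj a * fock_inner lam f g"
  using fock_inner_scale_left[of lam a g f] by (metis complex_cnj_mult fock_inner_commute)

lemma fock_inner_self:
  "fock_inner lam f f = of_real (LINT z|fock_measure lam. (cmod (f z))\<^sup>2 * exp (- lam * (norm z)\<^sup>2 / 2))"
  unfolding fock_inner_def integral_complex_of_real[symmetric]
  by (simp only: of_real_mult complex_norm_square)

lemma fock_norm_inner: "fock_norm lam f = sqrt (Re (fock_inner lam f f))"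
  by (simp add: fock_inner_self fock_norm_def)

lemma fock_norm_scale: "fock_norm lam (\<lambda>z. a * f z) = cmod a * fock_norm lam f"
  by (simp add: fock_norm_def norm_mult power_mult_distrib mult.assoc real_sqrt_mult)

lemma emeasure_fock_measure_UNIV:
  assumes "lam > 0"
  shows "emeasure (fock_measure lam :: (complex ^ 'n::finite) measure) UNIV \<noteq> 0"
  using assms by (simp add: fock_measure_def emeasure_density_const ennreal_eq_0_iff not_le)

text \<open>A strictly positive weight has integral zero only for the zero measure. The number is
  carried along as a common factor below and divided out.\<close>

lemma fock_inner_one_nonzero:
  assumes "lam > 0"
  shows "fock_inner lam (\<lambda>_::complex ^ 'n::finite. 1) (\<lambda>_. 1) \<noteq> 0"
proof
  let ?M = "fock_measure lam :: (complex ^ 'n) measure"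
  assume "fock_inner lam (\<lambda>_::complex ^ 'n. 1) (\<lambda>_. 1) = 0"
  then have "(LINT z|?M. exp (- lam * (norm z)\<^sup>2 / 2)) = 0" by (simp add: fock_inner_self)
  then have "AE z in ?M. exp (- lam * (norm z)\<^sup>2 / 2) = 0"
    using integral_nonneg_eq_0_iff_AE[OF integrable_fock_gaussian[OF assms, where 'n='n]] by simp
  then have "AE z in ?M. False" by simp
  then have "emeasure ?M UNIV = 0" by (simp add: AE_iff_null null_sets_def)
  with emeasure_fock_measure_UNIV[OF assms] show False by blast
qed

lemma fock_inner_one:
  fixes f :: "complex ^ 'n::finite \<Rightarrow> complex"
  assumes "lam > 0" "f \<in> fock_space lam"
  shows "fock_inner lam f (\<lambda>_. 1) = f 0 * fock_inner lam (\<lambda>_::complex ^ 'n. 1) (\<lambda>_. 1)"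
  using fock_mean_value[OF assms] by (simp add: fock_inner_self) (simp add: fock_inner_def)

section \<open>The Hermitian product and the Heisenberg group law\<close>

lemma Re_cdot_vcnj: "Re (cdot (vcnj a) b) = a \<bullet> b"
  by (simp add: cdot_def vcnj_def inner_vec_def inner_complex_def)

lemma cdot_add_right: "cdot a (b + c) = cdot a b + cdot a c"
  and cdot_diff_right: "cdot a (b - c) = cdot a b - cdot a c"
  and cdot_add_left: "cdot (a + b) c = cdot a c + cdot b c"
  and cdot_scale_right: "cdot a (u *s b) = u * cdot a b"
  and cdot_scaleR_right: "cdot a (r *\<^sub>R b) = r *\<^sub>R cdot a b"
  and cdot_commute: "cdot a b = cdot b a"
  and vcnj_add: "vcnj (a + b) = vcnj a + vcnj b"
  and cnj_cdot: "cnj (cdot a b) = cdot (vcnj a) (vcnj b)"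
  and vcnj_vcnj: "vcnj (vcnj a) = a"
  by (simp_all add: cdot_def vcnj_def vec_eq_iff sum.distrib sum_subtractf algebra_simps sum_distrib_left scaleR_sum_right)

lemma Re_omega: "Re (omega (a, vcnj a) (b, vcnj b)) = Im (cdot (vcnj a) b)"
proof -
  have "cdot a (vcnj b) = cnj (cdot (vcnj a) b)" "cdot b (vcnj a) = cdot (vcnj a) b"
    by (simp_all add: cnj_cdot vcnj_vcnj cdot_commute)
  then show ?thesis by (simp add: omega_def)
qed

text \<open>Both sides translate by \<open>a + b\<close>, so only exponents are compared. The cross
  term of the composition is \<open>- lam / 2 * cnj q\<close>; its real part is the cross term of
  the squared norm of \<open>a + b\<close>, its imaginary part the central term of the group
  law.\<close>

lemma bargmann_fock_mult:
  "bargmann_fock lam h (bargmann_fock lam k f) = bargmann_fock lam (heis_mult h k) f"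
proof -
  obtain a c b d where hk: "h = (a, c)" "k = (b, d)" by (metis surj_pair)
  define q where "q = cdot (vcnj a) b"
  have q: "cdot (vcnj b) a = cnj q"
    by (simp add: q_def cnj_cdot vcnj_vcnj cdot_commute)
  have n: "(norm (a + b))\<^sup>2 = (norm a)\<^sup>2 + (norm b)\<^sup>2 + 2 * Re q"
    by (simp add: q_def Re_cdot_vcnj power2_norm_eq_inner inner_add inner_commute)
  show ?thesis
  proof
    fix z
    have "\<i> * of_real (lam * c) + of_real (lam / 2) * cdot (vcnj a) z - of_real (lam / 4 * (norm a)\<^sup>2)
      + (\<i> * of_real (lam * d) + of_real (lam / 2) * cdot (vcnj b) (z - a) - of_real (lam / 4 * (norm b)\<^sup>2))
      = \<i> * of_real (lam * (c + d + 1 / 2 * Im q)) + of_real (lam / 2) * cdot (vcnj (a + b)) z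
        - of_real (lam / 4 * (norm (a + b))\<^sup>2)"
      unfolding n cdot_diff_right vcnj_add cdot_add_left q
      by (simp add: complex_eq_iff field_simps)
    then show "bargmann_fock lam h (bargmann_fock lam k f) z = bargmann_fock lam (heis_mult h k) f z"
      by (simp add: hk bargmann_fock_def heis_mult_def Re_omega q_def[symmetric] exp_add[symmetric] mult.assoc[symmetric]
        diff_diff_eq)
  qed
qed

lemma bargmann_fock_zero: "bargmann_fock lam (0, 0) f = f"
  by (simp add: bargmann_fock_def cdot_def vcnj_def fun_eq_iff)

lemma bargmann_fock_inverse:
  "bargmann_fock lam (a, c) (bargmann_fock lam (- a, - c) f) = f"
  by (simp add: bargmann_fock_mult heis_mult_def Re_omega bargmann_fock_zero)
    (simp add: cdot_def vcnj_def bargmann_fock_zero sum_negf)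

lemma distr_lborel_translate: "distr lborel borel (\<lambda>z::'a::euclidean_space. z - a) = lborel"
  using lborel_distr_plus[of "- a"] by (simp add: add.commute[of "- a"] fun_eq_iff cong: distr_cong)

text \<open>Completing the square: the exponential factor times its conjugate turns the Gaussian
  centred at 0 into the one centred at \<open>a\<close>, and the central phase cancels. With
  translation invariance this gives both membership and unitarity.\<close>

lemma bargmann_fock_weight:
  "bargmann_fock lam (a, c) f z * cnj (bargmann_fock lam (a, c) g z) * of_real (exp (- lam * (norm z)\<^sup>2 / 2))
   = f (z - a) * cnj (g (z - a)) * of_real (exp (- lam * (norm (z - a))\<^sup>2 / 2))"
proof -
  define e where "e = \<i> * of_real (lam * c) + of_real (lam / 2) * cdot (vcnj a) z - of_real (lam / 4 * (norm a)\<^sup>2)"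
  have dist: "(norm (z - a))\<^sup>2 = (norm z)\<^sup>2 + (norm a)\<^sup>2 - 2 * Re (cdot (vcnj a) z)"
    by (simp add: Re_cdot_vcnj power2_norm_eq_inner inner_diff inner_commute)
  have "e + cnj e + of_real (- lam * (norm z)\<^sup>2 / 2) = of_real (- lam * (norm (z - a))\<^sup>2 / 2)"
    unfolding e_def dist by (simp add: complex_eq_iff field_simps)
  then have "exp e * cnj (exp e) * of_real (exp (- lam * (norm z)\<^sup>2 / 2)) = of_real (exp (- lam * (norm (z - a))\<^sup>2 / 2))"
    by (simp add: exp_cnj exp_of_real[symmetric] exp_add[symmetric])
  moreover have "bargmann_fock lam (a, c) k z = exp e * k (z - a)" for k
    by (simp add: bargmann_fock_def e_def)
  ultimately show ?thesis by (simp add: mult_ac del: exp_cnj)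
qed

lemma bargmann_fock_inner:
  assumes "f \<in> fock_space lam" "g \<in> fock_space lam"
  shows "fock_inner lam (bargmann_fock lam h f) (bargmann_fock lam h g) = fock_inner lam f g"
proof -
  obtain a c where h: "h = (a, c)" by (metis surj_pair)
  have [measurable]: "f \<in> borel_measurable borel" "g \<in> borel_measurable borel"
    using assms fock_measurable by auto
  show ?thesis
    unfolding fock_inner_def h bargmann_fock_weight
    by (rule integral_fock_measure_invariant(1)[OF _ _ distr_lborel_translate,
        where f = "\<lambda>z. f z * cnj (g z) * of_real (exp (- lam * (norm z)\<^sup>2 / 2))"]) measurable
qed

lemma bargmann_fock_space:
  assumes f: "f \<in> fock_space lam"
  shows "bargmann_fock lam h f \<in> fock_space lam"
proof -
  obtain a c where h: "h = (a, c)" by (metis surj_pair)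
  have [measurable]: "f \<in> borel_measurable borel" using f fock_measurable by auto
  have "entire_Cn (\<lambda>z. cdot (vcnj a) z)"
    by (intro entire_linear linearI)
      (simp_all add: cdot_add_right cdot_scale_right cdot_scaleR_right)
  then have "entire_Cn (\<lambda>z. exp ((\<i> * of_real (lam * c) - of_real (lam / 4 * (norm a)\<^sup>2))
      + of_real (lam / 2) * cdot (vcnj a) z) * f (z - a))"
    using f by (intro entire_mult entire_exp entire_add entire_const entire_translate) (auto simp: fock_space_def)
  then have "entire_Cn (bargmann_fock lam h f)"
    by (simp add: h bargmann_fock_def algebra_simps)
  moreover have "(cmod (bargmann_fock lam h f z))\<^sup>2 * exp (- lam * (norm z)\<^sup>2 / 2)
      = (cmod (f (z - a)))\<^sup>2 * exp (- lam * (norm (z - a))\<^sup>2 / 2)" for z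
    using bargmann_fock_weight[of lam a c f z f]
    by (simp add: h complex_norm_square[symmetric] flip: of_real_mult of_real_power del: of_real_exp)
  then have "integrable (fock_measure lam) (\<lambda>z. (cmod (bargmann_fock lam h f z))\<^sup>2 * exp (- lam * (norm z)\<^sup>2 / 2))"
    using f integral_fock_measure_invariant(2)[OF _ _ distr_lborel_translate[of a],
        where f = "\<lambda>z. (cmod (f z))\<^sup>2 * exp (- lam * (norm z)\<^sup>2 / 2)" and lam = lam]
    by (simp add: fock_space_def)
  ultimately show ?thesis by (simp add: fock_space_def)
qed

lemma bargmann_fock_unitary: "fock_unitary lam (bargmann_fock lam h)"
proof -
  obtain a c where h: "h = (a, c)" by (metis surj_pair)
  \<comment> \<open>Surjectivity: a preimage is the image of \<open>f\<close> under the operator of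
    the inverse group element.\<close>
  have "f \<in> bargmann_fock lam h ` fock_space lam" if "f \<in> fock_space lam" for f
    using bargmann_fock_inverse[of lam a c f] bargmann_fock_space[OF that] h by (metis imageI)
  then show ?thesis
    unfolding fock_unitary_def fock_operator_def
    by (auto simp: bargmann_fock_space bargmann_fock_inner) (auto simp: h bargmann_fock_def algebra_simps)
qed

text \<open>By unitarity the translation moves to the left factor as \<open>(- w, 0)\<close>, and
  pairing with the constant 1 then evaluates at 0, where the translated function takes the value of
  \<open>f\<close> at \<open>w\<close> up to the Gaussian factor.\<close>

lemma reproducing_property:
  fixes f :: "complex ^ 'n::finite \<Rightarrow> complex"
  assumes lam: "lam > 0" and f: "f \<in> fock_space lam"
  shows "fock_inner lam f (bargmann_fock lam (w, 0) (\<lambda>_. 1))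
    = of_real (exp (- lam / 4 * (norm w)\<^sup>2)) * f w * fock_inner lam (\<lambda>_::complex ^ 'n. 1) (\<lambda>_. 1)"
proof -
  have "fock_inner lam f (bargmann_fock lam (w, 0) (\<lambda>_. 1))
    = fock_inner lam (bargmann_fock lam (- w, 0) f) (\<lambda>_. 1)"
    using bargmann_fock_inner[OF bargmann_fock_space[OF f] fock_space_const[OF lam], of "(w, 0)" "(- w, 0)" 1]
      bargmann_fock_inverse[of lam w 0 f] by simp
  also have "\<dots> = bargmann_fock lam (- w, 0) f 0 * fock_inner lam (\<lambda>_::complex ^ 'n. 1) (\<lambda>_. 1)"
    by (rule fock_inner_one[OF lam bargmann_fock_space[OF f]])
  also have "bargmann_fock lam (- w, 0) f 0 = of_real (exp (- lam / 4 * (norm w)\<^sup>2)) * f w"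
    by (simp add: bargmann_fock_def cdot_def exp_of_real[symmetric])
  finally show ?thesis .
qed

text \<open>Pointwise convergence with constant norms gives norm convergence. This reduces strong
  continuity of a unitary family to pointwise continuity.\<close>

lemma fock_norm_tendsto_zero:
  fixes F :: "nat \<Rightarrow> complex ^ 'n::finite \<Rightarrow> complex"
  assumes F: "\<And>n. F n \<in> fock_space lam" and G: "G \<in> fock_space lam"
    and lim: "\<And>z. (\<lambda>n. F n z) \<longlonglongrightarrow> G z"
    and nrm: "\<And>n. fock_inner lam (F n) (F n) = fock_inner lam G G"
  shows "(\<lambda>n. fock_norm lam (\<lambda>z. F n z - G z)) \<longlonglongrightarrow> 0"
proof -
  let ?M = "fock_measure lam :: (complex ^ 'n) measure"
  define w where "w z = exp (- lam * (norm z)\<^sup>2 / 2)" for z :: "complex ^ 'n"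
  define N where "N = (LINT z|?M. (cmod (G z))\<^sup>2 * w z)"
  define H where "H n z = (cmod (F n z + G z))\<^sup>2 * w z" for n z
  \<comment> \<open>\<open>L\<close> is the pointwise limit of \<open>H n\<close>, because
    \<open>F n + G\<close> tends to \<open>2 G\<close>.\<close>
  define L where "L z = 4 * ((cmod (G z))\<^sup>2 * w z)" for z
  have int: "integrable ?M (\<lambda>z. (cmod (f z))\<^sup>2 * w z)" if "f \<in> fock_space lam" for f
    using that by (simp add: fock_space_def w_def)
  have Fint: "(LINT z|?M. (cmod (F n z))\<^sup>2 * w z) = N" for n
    using nrm[of n] unfolding fock_inner_self N_def w_def of_real_eq_iff .
  have H: "integrable ?M (H n)" for n
    unfolding H_def by (rule int[OF fock_space_add[OF F G]])
  have D: "integrable ?M (\<lambda>z. (cmod (F n z - G z))\<^sup>2 * w z)" for n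
    by (rule int[OF fock_space_diff[OF F G]])
  have L: "integrable ?M L" unfolding L_def using int[OF G] by simp
  have parallelogram: "(cmod (F n z - G z))\<^sup>2 * w z = 2 * ((cmod (F n z))\<^sup>2 * w z) + 2 * ((cmod (G z))\<^sup>2 * w z) - H n z" for n z
    unfolding H_def cmod_power2 by (simp add: power2_eq_square algebra_simps)
  have Dint: "(LINT z|?M. (cmod (F n z - G z))\<^sup>2 * w z) = 4 * N - integral\<^sup>L ?M (H n)" for n
    unfolding parallelogram using H[of n] int[OF F[of n]] int[OF G]
    by (simp add: Fint N_def[symmetric])
  have Lint: "integral\<^sup>L ?M L = 4 * N" unfolding L_def N_def by simp
  have H0: "0 \<le> H n z" and L0: "0 \<le> L z" for n z by (simp_all add: H_def L_def w_def)
  have D0: "0 \<le> (LINT z|?M. (cmod (F n z - G z))\<^sup>2 * w z)" for n by (simp add: w_def)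
  have "(\<lambda>n. \<integral>\<^sup>+ z. norm (H n z - L z) \<partial>?M) \<longlonglongrightarrow> 0"
  proof (rule Scheffe_lemma2[OF _ L])
    show "H n \<in> borel_measurable ?M" for n using H by simp
    show "AE z in ?M. (\<lambda>n. H n z) \<longlonglongrightarrow> L z"
    proof (rule AE_I2)
      fix z
      have "(\<lambda>n. (cmod (F n z + G z))\<^sup>2 * w z) \<longlonglongrightarrow> (cmod (G z + G z))\<^sup>2 * w z"
        by (intro tendsto_intros lim)
      moreover have "(cmod (G z + G z))\<^sup>2 = 4 * (cmod (G z))\<^sup>2"
        unfolding cmod_power2 by (simp add: power2_eq_square)
      ultimately show "(\<lambda>n. H n z) \<longlonglongrightarrow> L z" by (simp add: H_def L_def mult.assoc)
    qed
    \<comment> \<open>The bound required by Scheffe's lemma: by \<open>Dint\<close>,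
      \<open>4 * N\<close> minus the integral of \<open>H n\<close> is the integral of a nonnegative
      function, and \<open>4 * N\<close> is the integral of \<open>L\<close>.\<close>
    show "(\<integral>\<^sup>+ z. norm (H n z) \<partial>?M) \<le> (\<integral>\<^sup>+ z. norm (L z) \<partial>?M)" for n
      using Dint[of n] D0[of n] H[of n] L H0 L0 Lint
      by (simp add: nn_integral_eq_integral ennreal_leI)
  qed
  also have "(\<lambda>n. \<integral>\<^sup>+ z. norm (H n z - L z) \<partial>?M) = (\<lambda>n. ennreal (LINT z|?M. norm (H n z - L z)))"
    using H L by (intro ext nn_integral_eq_integral) auto
  finally have "(\<lambda>n. ennreal (LINT z|?M. norm (H n z - L z))) \<longlonglongrightarrow> ennreal 0" by simp
  then have lim0: "(\<lambda>n. LINT z|?M. norm (H n z - L z)) \<longlonglongrightarrow> 0"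
    by (rule tendsto_ennrealD) (auto intro!: always_eventually Bochner_Integration.integral_nonneg)
  have "(\<lambda>n. LINT z|?M. (cmod (F n z - G z))\<^sup>2 * w z) \<longlonglongrightarrow> 0"
  proof (rule tendsto_sandwich[OF _ _ tendsto_const lim0])
    have "(LINT z|?M. (cmod (F n z - G z))\<^sup>2 * w z) = (LINT z|?M. L z - H n z)" for n
      using H L by (simp add: Dint Lint)
    also have "(LINT z|?M. L z - H n z) \<le> (LINT z|?M. norm (H n z - L z))" for n
      using H L by (intro integral_mono) auto
    finally show "\<forall>\<^sub>F n in sequentially. (LINT z|?M. (cmod (F n z - G z))\<^sup>2 * w z) \<le> (LINT z|?M. norm (H n z - L z))"
      by simp
  qed (simp add: D0)
  then show ?thesis
    unfolding fock_norm_def w_def using tendsto_real_sqrt by fastforce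
qed

section \<open>The rotation action on the Fock space and its compatibility with the Heisenberg
  operators\<close>

lemma act_component: "act \<alpha> t z $ k = exp (\<i> * of_real (\<alpha> k t)) * z $ k"
  by (simp add: act_def)

lemma act_linear: "linear (act \<alpha> t)"
  by (rule linearI) (simp_all add: vec_eq_iff act_component algebra_simps)

lemma act_scale: "act \<alpha> t (c *s z) = c *s act \<alpha> t z"
  by (simp add: vec_eq_iff act_component)

lemma orthogonal_act: "orthogonal_transformation (act \<alpha> t)"
  unfolding orthogonal_transformation
  by (simp add: act_linear norm_vec_def act_component norm_mult)

lemma norm_act: "norm (act \<alpha> t z) = norm z"
  using orthogonal_act by (auto simp: orthogonal_transformation)

lemma act_measurable [measurable]: "act \<alpha> t \<in> borel \<rightarrow>\<^sub>M borel"
  using act_linear[of \<alpha> t] by (simp add: borel_measurable_continuous_onI linear_continuous_on linear_conv_bounded_linear)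

lemma act_add:
  assumes "\<And>k. linear (\<alpha> k)"
  shows "act \<alpha> (s + t) z = act \<alpha> s (act \<alpha> t z)"
  by (simp add: vec_eq_iff act_component linear_add[OF assms] algebra_simps exp_add)

lemma act_zero:
  assumes "\<And>k. linear (\<alpha> k)"
  shows "act \<alpha> 0 z = z"
  by (simp add: vec_eq_iff act_component linear_0[OF assms])

lemma act_inverse:
  assumes "\<And>k. linear (\<alpha> k)"
  shows "act \<alpha> t (act \<alpha> (- t) z) = z" "act \<alpha> (- t) (act \<alpha> t z) = z"
  using act_add[of \<alpha> t "- t" z] act_add[of \<alpha> "- t" t z] act_zero[of \<alpha> z] assms by auto

text \<open>The adjoint of a diagonal unitary matrix is its inverse; conjugating the phases replaces
  \<open>t\<close> by \<open>- t\<close>.\<close>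

lemma cdot_act:
  assumes "\<And>k. linear (\<alpha> k)"
  shows "cdot (vcnj (act \<alpha> t a)) b = cdot (vcnj a) (act \<alpha> (- t) b)"
  by (simp add: cdot_def vcnj_def act_component exp_cnj linear_neg[OF assms] mult_ac)

lemma continuous_on_act:
  assumes "\<And>k. linear (\<alpha> k)" and "continuous_on A t" "continuous_on A z"
  shows "continuous_on A (\<lambda>x. act \<alpha> (t x) (z x))"
proof -
  have "continuous_on A (\<lambda>x. \<alpha> k (t x))" for k
    using linear_continuous_on[of "\<alpha> k" UNIV] assms(1)[of k]
    by (intro continuous_on_compose2[OF _ assms(2), where t = UNIV])
      (auto simp: linear_conv_bounded_linear)
  then show ?thesis unfolding act_def by (intro continuous_intros assms)
qed

lemma rotate_fock_space:
  assumes f: "f \<in> fock_space lam"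
  shows "(\<lambda>z. f (act \<alpha> t z)) \<in> fock_space lam"
proof -
  have [measurable]: "f \<in> borel_measurable borel" using f fock_measurable by auto
  have "entire_Cn (\<lambda>z. f (act \<alpha> t z))"
    using entire_compose_affine[OF _ act_linear act_scale, where f = f and b = 0] f by (simp add: fock_space_def)
  moreover have "integrable (fock_measure lam) (\<lambda>z. (cmod (f (act \<alpha> t z)))\<^sup>2 * exp (- lam * (norm z)\<^sup>2 / 2))"
    using f integral_fock_measure_invariant(2)[OF act_measurable _ distr_lborel_orthogonal[OF orthogonal_act],
        where f = "\<lambda>z. (cmod (f z))\<^sup>2 * exp (- lam * (norm z)\<^sup>2 / 2)" and lam = lam]
    by (simp add: fock_space_def norm_act)
  ultimately show ?thesis by (simp add: fock_space_def)
qed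

lemma rotate_fock_inner:
  assumes "f \<in> fock_space lam" "g \<in> fock_space lam"
  shows "fock_inner lam (\<lambda>z. f (act \<alpha> t z)) (\<lambda>z. g (act \<alpha> t z)) = fock_inner lam f g"
proof -
  have [measurable]: "f \<in> borel_measurable borel" "g \<in> borel_measurable borel"
    using assms fock_measurable by auto
  show ?thesis
    using integral_fock_measure_invariant(1)[OF act_measurable _ distr_lborel_orthogonal[OF orthogonal_act],
        where f = "\<lambda>z. f z * cnj (g z) * of_real (exp (- lam * (norm z)\<^sup>2 / 2))" and lam = lam]
    by (simp add: fock_inner_def norm_act)
qed

text \<open>The action of \<open>t\<close> preserves the Hermitian product, so rotations normalise
  the Heisenberg operators. This is the relation that makes the semidirect product law come out in
  \<open>diamond_unitary_repI\<close>.\<close>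

lemma rotate_bargmann_fock:
  assumes "\<And>k. linear (\<alpha> k)"
  shows "bargmann_fock lam (a, c) f (act \<alpha> (- t) z)
    = bargmann_fock lam (act \<alpha> t a, c) (\<lambda>z. f (act \<alpha> (- t) z)) z"
  by (simp add: bargmann_fock_def cdot_act[OF assms] norm_act linear_diff[OF act_linear] act_inverse[OF assms])

lemma bargmann_fock_scale: "bargmann_fock lam h (\<lambda>z. a * f z) = (\<lambda>z. a * bargmann_fock lam h f z)"
  by (simp add: bargmann_fock_def case_prod_beta fun_eq_iff)

text \<open>Operators are total functions with arbitrary values outside
  \<open>fock_space lam\<close>, so unitarity has to be transferred along agreement on that
  set.\<close>

lemma fock_unitary_cong:
  assumes U: "fock_unitary lam U" and V: "\<And>f. f \<in> fock_space lam \<Longrightarrow> V f = U f"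
  shows "fock_unitary lam V"
proof -
  have "V ` fock_space lam = U ` fock_space lam" using V by simp
  then show ?thesis
    using U unfolding fock_unitary_def fock_operator_def
    by (simp add: V fock_space_add fock_space_scale)
qed

lemma fock_unitary_comp:
  assumes U: "fock_unitary lam U" and V: "fock_unitary lam V"
  shows "fock_unitary lam (U \<circ> V)"
proof -
  have "(U \<circ> V) ` fock_space lam = fock_space lam"
    using U V unfolding fock_unitary_def image_comp[symmetric] by metis
  moreover have "V f \<in> fock_space lam" if "f \<in> fock_space lam" for f
    using V that by (simp add: fock_unitary_def fock_operator_def)
  ultimately show ?thesis
    using U V unfolding fock_unitary_def fock_operator_def by simp
qed

lemma rotate_fock_unitary:
  assumes \<alpha>: "\<And>k. linear (\<alpha> k)" and "cmod c = 1"
  shows "fock_unitary lam (\<lambda>f z. c * f (act \<alpha> t z))"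
proof -
  have c: "c * cnj c = 1" using assms(2) by (simp add: complex_norm_square[symmetric])
  have mem: "(\<lambda>z. c * f (act \<alpha> t z)) \<in> fock_space lam" if "f \<in> fock_space lam" for f
    by (intro fock_space_scale rotate_fock_space that)
  have "f \<in> (\<lambda>f z. c * f (act \<alpha> t z)) ` fock_space lam" if "f \<in> fock_space lam" for f
  \<comment> \<open>The preimage undoes the rotation and the phase: \<open>cnj c\<close> is the
    inverse of \<open>c\<close>.\<close>
  proof (rule image_eqI)
    show "f = (\<lambda>z. c * (\<lambda>z. cnj c * f (act \<alpha> (- t) z)) (act \<alpha> t z))"
      by (simp add: act_inverse[OF \<alpha>] mult.assoc[symmetric] c)
    show "(\<lambda>z. cnj c * f (act \<alpha> (- t) z)) \<in> fock_space lam"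
      by (intro fock_space_scale rotate_fock_space that)
  qed
  with mem have "(\<lambda>f z. c * f (act \<alpha> t z)) ` fock_space lam = fock_space lam" by blast
  moreover have "fock_operator lam (\<lambda>f z. c * f (act \<alpha> t z))"
    unfolding fock_operator_def using mem by (auto simp: distrib_left)
  moreover have "fock_inner lam (\<lambda>z. c * f (act \<alpha> t z)) (\<lambda>z. c * g (act \<alpha> t z)) = fock_inner lam f g"
    if "f \<in> fock_space lam" "g \<in> fock_space lam" for f g
    by (simp only: fock_inner_scale_left fock_inner_scale_right rotate_fock_inner[OF that]
        mult.assoc[symmetric] c mult_1_left)
  ultimately show ?thesis
    unfolding fock_unitary_def by blast
qed

section \<open>Representations of the diamond group\<close>

text \<open>Each operator is a Heisenberg operator after a rotation with a phase, hence unitary. The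
  group law follows by moving the rotation past the second Heisenberg operator.\<close>

lemma diamond_unitary_repI:
  fixes lam :: real and \<alpha> :: "'n::finite \<Rightarrow> real ^ 'm::finite \<Rightarrow> real"
  assumes \<alpha>: "\<And>k. linear (\<alpha> k)" and chi: "unitary_character chi"
    and \<pi>: "\<And>t h f. f \<in> fock_space lam \<Longrightarrow>
      \<pi> (t, h) f = bargmann_fock lam h (\<lambda>z. chi t * f (act \<alpha> (- t) z))"
  shows "unitary_rep (diamond_mult \<alpha>) lam \<pi>"
  unfolding unitary_rep_def
proof (intro conjI allI ballI)
  have cont_chi: "continuous_on UNIV chi" and norm_chi: "\<And>t. cmod (chi t) = 1"
    and chi_add: "\<And>s t. chi (s + t) = chi s * chi t"
    using chi by (auto simp: unitary_character_def)
  show unitary: "fock_unitary lam (\<pi> x)" for x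
  proof -
    obtain t h where x: "x = (t, h)" by (metis surj_pair)
    show ?thesis
      unfolding x
      by (rule fock_unitary_cong[OF fock_unitary_comp[OF bargmann_fock_unitary rotate_fock_unitary[OF \<alpha> norm_chi]]])
        (simp add: \<pi>)
  qed
  have mem: "\<pi> x f \<in> fock_space lam" if "f \<in> fock_space lam" for x f
    using unitary that by (auto simp: fock_unitary_def fock_operator_def)
  fix f :: "complex ^ 'n \<Rightarrow> complex" assume f: "f \<in> fock_space lam"
  show "\<pi> (diamond_mult \<alpha> x y) f = \<pi> x (\<pi> y f)" for x y
  proof -
    obtain t a c where x: "x = (t, a, c)" by (metis surj_pair)
    obtain s b d where y: "y = (s, b, d)" by (metis surj_pair)
    have "\<pi> x (\<pi> y f) = bargmann_fock lam (a, c) (\<lambda>z. chi t * \<pi> y f (act \<alpha> (- t) z))"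
      using \<pi>[OF mem[OF f]] by (simp add: x)
    also have "\<dots> = bargmann_fock lam (a, c) (bargmann_fock lam (act \<alpha> t b, d)
        (\<lambda>z. chi t * (chi s * f (act \<alpha> (- s) (act \<alpha> (- t) z)))))"
      by (simp add: y \<pi>[OF f] rotate_bargmann_fock[OF \<alpha>] bargmann_fock_scale)
    also have "(\<lambda>z. chi t * (chi s * f (act \<alpha> (- s) (act \<alpha> (- t) z))))
        = (\<lambda>z. chi (t + s) * f (act \<alpha> (- (t + s)) z))"
      by (simp only: chi_add mult.assoc minus_add act_add[OF \<alpha>, symmetric])
    finally show ?thesis
      by (simp add: x y bargmann_fock_mult diamond_mult_def case_prod_beta \<pi>[OF f])
  qed
  show "((\<lambda>y. fock_norm lam (\<lambda>z. \<pi> y f z - \<pi> x f z)) \<longlongrightarrow> 0) (at x)" for x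
    unfolding tendsto_at_iff_sequentially comp_def
  proof (intro allI impI fock_norm_tendsto_zero mem f)
    fix X assume X: "X \<longlonglongrightarrow> x"
    fix z
    have cont_f: "continuous_on UNIV f" using f by (simp add: fock_space_def entire_continuous)
    \<comment> \<open>For fixed \<open>z\<close> the explicit formula is continuous in the group
      element, which supplies the pointwise convergence for
      \<open>fock_norm_tendsto_zero\<close>.\<close>
    have "continuous_on UNIV (\<lambda>y. exp (\<i> * of_real (lam * snd (snd y))
        + of_real (lam / 2) * cdot (vcnj (fst (snd y))) z - of_real (lam / 4 * (norm (fst (snd y)))\<^sup>2))
        * (chi (fst y) * f (act \<alpha> (- fst y) (z - fst (snd y)))))"
      unfolding cdot_def vcnj_def
      by (intro continuous_intros continuous_on_compose2[OF cont_f] continuous_on_compose2[OF cont_chi]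
          continuous_on_act \<alpha>) auto
    moreover have "\<pi> y f z = exp (\<i> * of_real (lam * snd (snd y))
        + of_real (lam / 2) * cdot (vcnj (fst (snd y))) z - of_real (lam / 4 * (norm (fst (snd y)))\<^sup>2))
        * (chi (fst y) * f (act \<alpha> (- fst y) (z - fst (snd y))))" for y
      by (cases y) (simp add: \<pi>[OF f] bargmann_fock_def)
    ultimately have "continuous_on UNIV (\<lambda>y. \<pi> y f z)" by (simp only:)
    from continuous_on_tendsto_compose[OF this X] show "(\<lambda>n. \<pi> (X n) f z) \<longlonglongrightarrow> \<pi> x f z"
      by simp
  next
    fix X :: "nat \<Rightarrow> _" and n
    show "fock_inner lam (\<pi> (X n) f) (\<pi> (X n) f) = fock_inner lam (\<pi> x f) (\<pi> x f)"
      using unitary f by (simp add: fock_unitary_def)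
  qed
qed

lemma diamond_unitary_repE:
  fixes lam :: real and \<alpha> :: "'n::finite \<Rightarrow> real ^ 'm::finite \<Rightarrow> real"
    and \<pi> :: "(real ^ 'm) \<times> (complex ^ 'n) \<times> real \<Rightarrow>
                 (complex ^ 'n \<Rightarrow> complex) \<Rightarrow> complex ^ 'n \<Rightarrow> complex"
  assumes \<alpha>: "\<And>k. linear (\<alpha> k)" and lam: "lam > 0"
    and \<pi>: "\<And>t h. \<pi> (t, h) = bargmann_fock lam h \<circ> \<sigma> t"
    and rep: "unitary_rep (diamond_mult \<alpha>) lam \<pi>"
  obtains chi where "unitary_character chi"
    "\<And>t f z. f \<in> fock_space lam \<Longrightarrow> \<sigma> t f z = chi t * f (act \<alpha> (- t) z)"
proof -
  let ?one = "\<lambda>_::complex ^ 'n. 1::complex"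
  let ?\<rho> = "\<lambda>w. bargmann_fock lam (w :: complex ^ 'n, 0)"
  define K where "K = fock_inner lam ?one ?one"
  have K: "K \<noteq> 0" unfolding K_def by (rule fock_inner_one_nonzero[OF lam])
  have K_cnj: "cnj K = K" unfolding K_def by (simp add: fock_inner_self)
  define gauss where "gauss w = complex_of_real (exp (- lam / 4 * (norm w)\<^sup>2))" for w :: "complex ^ 'n"
  have gauss_nz: "gauss w \<noteq> 0" and gauss_act: "gauss (act \<alpha> t w) = gauss w" and gauss_cnj: "cnj (gauss w) = gauss w" for w t
    by (simp_all add: gauss_def norm_act)
  have one: "?one \<in> fock_space lam" by (rule fock_space_const[OF lam])
  have \<rho>one: "?\<rho> w ?one \<in> fock_space lam" for w by (rule bargmann_fock_space[OF one])
  have repr: "fock_inner lam f (?\<rho> w ?one) = gauss w * f w * K" if "f \<in> fock_space lam" for f w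
    using reproducing_property[OF lam that] by (simp add: gauss_def K_def)
  \<comment> \<open>The identity of the Heisenberg group acts trivially, so
    \<open>\<sigma> t\<close> is the value of the representation at \<open>(t, 0, 0)\<close>;
    unitarity and the group law for \<open>\<sigma>\<close> come from there.\<close>
  have \<sigma>_\<pi>: "\<sigma> t f = \<pi> (t, 0, 0) f" for t f by (simp add: \<pi> bargmann_fock_zero)
  have unitary: "fock_unitary lam (\<sigma> t)" for t
    using rep by (simp add: \<sigma>_\<pi>[abs_def] unitary_rep_def)
  have mem: "\<sigma> t f \<in> fock_space lam" if "f \<in> fock_space lam" for t f
    using unitary that by (auto simp: fock_unitary_def fock_operator_def)
  have inner: "fock_inner lam (\<sigma> t f) (\<sigma> t g) = fock_inner lam f g"
    if "f \<in> fock_space lam" "g \<in> fock_space lam" for t f g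
    using unitary that by (simp add: fock_unitary_def)
  have scale: "\<sigma> t (\<lambda>z. a * f z) = (\<lambda>z. a * \<sigma> t f z)" if "f \<in> fock_space lam" for t a f
    using unitary that by (simp add: fock_unitary_def fock_operator_def)
  have hom: "\<pi> (diamond_mult \<alpha> x y) f = \<pi> x (\<pi> y f)" if "f \<in> fock_space lam" for x y f
    using rep that unfolding unitary_rep_def by blast
  have act_0: "act \<alpha> t 0 = 0" for t by (rule linear_0[OF act_linear])
  have cdot_0: "cdot (vcnj 0) z = 0" "cdot z 0 = 0" for z :: "complex ^ 'n" by (simp_all add: cdot_def vcnj_def)
  have \<sigma>_add: "\<sigma> (s + t) f = \<sigma> s (\<sigma> t f)" if "f \<in> fock_space lam" for s t f
    using hom[OF that, of "(s, 0, 0)" "(t, 0, 0)"]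
    by (simp add: \<sigma>_\<pi> diamond_mult_def heis_mult_def act_0 Re_omega cdot_0)
  \<comment> \<open>\<open>\<sigma> 0\<close> is idempotent and maps onto the Fock space, hence is
    the identity on it.\<close>
  have \<sigma>_zero: "\<sigma> 0 f = f" if f: "f \<in> fock_space lam" for f
  proof -
    obtain g where "g \<in> fock_space lam" "f = \<sigma> 0 g"
      using unitary[of 0] f unfolding fock_unitary_def by blast
    then show ?thesis using \<sigma>_add[of g 0 0] by simp
  qed
  \<comment> \<open>This is the factorisation of \<open>(t, act \<alpha> t a, 0)\<close> as the
    product of \<open>(t, 0, 0)\<close> and \<open>(0, a, 0)\<close>.\<close>
  have inter: "\<sigma> t (?\<rho> a f) = ?\<rho> (act \<alpha> t a) (\<sigma> t f)" if f: "f \<in> fock_space lam" for t a f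
  proof -
    have "\<sigma> t (?\<rho> a f) = \<pi> (t, 0, 0) (\<pi> (0, a, 0) f)"
      by (simp add: \<pi> bargmann_fock_zero \<sigma>_zero[OF f])
    also have "\<dots> = \<pi> (t, act \<alpha> t a, 0) f"
      using hom[OF f, of "(t, 0, 0)" "(0, a, 0)"]
      by (simp add: diamond_mult_def heis_mult_def Re_omega cdot_0)
    finally show ?thesis by (simp add: \<pi>)
  qed
  have adjoint: "fock_inner lam (\<sigma> t f) g = fock_inner lam f (\<sigma> (- t) g)"
    if "f \<in> fock_space lam" "g \<in> fock_space lam" for t f g
    using inner[OF that(1) mem[OF that(2)], of t "- t"] \<sigma>_add[OF that(2), of t "- t"] \<sigma>_zero[OF that(2)]
    by simp
  \<comment> \<open>The inner product of \<open>\<sigma> t ?one\<close> with the coherent state at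
    \<open>v\<close> is computed by the reproducing property, and again by moving
    \<open>\<sigma> t\<close> to the other side, intertwining, and evaluating at 0. The right side
    is the conjugate of an entire function of \<open>v\<close>.\<close>
  have vac: "\<sigma> t ?one v = cnj (\<sigma> (- t) ?one (- act \<alpha> (- t) v))" for t v
  proof -
    have "gauss v * \<sigma> t ?one v * K = fock_inner lam ?one (\<sigma> (- t) (?\<rho> v ?one))"
      using adjoint[OF one \<rho>one, of t v] repr[OF mem[OF one], of t v] by simp
    also have "\<dots> = fock_inner lam ?one (?\<rho> (act \<alpha> (- t) v) (\<sigma> (- t) ?one))"
      by (simp add: inter[OF one])
    also have "\<dots> = cnj (fock_inner lam (?\<rho> (act \<alpha> (- t) v) (\<sigma> (- t) ?one)) ?one)"
      by (rule fock_inner_commute)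
    also have "fock_inner lam (?\<rho> (act \<alpha> (- t) v) (\<sigma> (- t) ?one)) ?one
        = ?\<rho> (act \<alpha> (- t) v) (\<sigma> (- t) ?one) 0 * K"
      unfolding K_def by (rule fock_inner_one[OF lam bargmann_fock_space[OF mem[OF one]]])
    also have "?\<rho> (act \<alpha> (- t) v) (\<sigma> (- t) ?one) 0 = gauss v * \<sigma> (- t) ?one (- act \<alpha> (- t) v)"
      by (simp add: bargmann_fock_def cdot_0 gauss_def norm_act exp_of_real[symmetric])
    finally have "gauss v * \<sigma> t ?one v * K = gauss v * cnj (\<sigma> (- t) ?one (- act \<alpha> (- t) v)) * K"
      by (simp only: complex_cnj_mult gauss_cnj K_cnj)
    then show ?thesis using K gauss_nz[of v] by simp
  qed
  define chi where "chi t = \<sigma> t ?one 0" for t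
  have \<sigma>_one: "\<sigma> t ?one = (\<lambda>_. chi t)" for t
  proof
    fix v
    have ent: "entire_Cn (\<sigma> s ?one)" for s using mem[OF one] by (simp add: fock_space_def)
    have "linear (\<lambda>v. - act \<alpha> (- t) v)" using act_linear linear_compose_neg by blast
    then have "entire_Cn (\<lambda>v. cnj (\<sigma> t ?one v))"
      using entire_compose_affine[OF ent[of "- t"], where L = "\<lambda>v. - act \<alpha> (- t) v" and b = 0]
      unfolding vac[of t] by (simp add: act_scale vec_eq_iff)
    from entire_cnj_imp_const[OF ent this] show "\<sigma> t ?one v = chi t" unfolding chi_def .
  qed
  \<comment> \<open>Unitarity applied to the constant 1, which \<open>\<sigma> t\<close> multiplies
    by \<open>chi t\<close>.\<close>
  have norm_chi: "cmod (chi t) = 1" for t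
  proof -
    have "chi t * cnj (chi t) * K = K"
      using inner[OF one one, of t] fock_inner_scale_left[of lam "chi t" ?one "\<lambda>z. chi t * ?one z"]
        fock_inner_scale_right[of lam ?one "chi t" ?one]
      by (simp add: \<sigma>_one K_def mult.commute)
    then have "chi t * cnj (chi t) = 1" using K by simp
    then have "complex_of_real ((cmod (chi t))\<^sup>2) = 1" unfolding complex_norm_square .
    then have "(cmod (chi t))\<^sup>2 = 1" using of_real_eq_1_iff by blast
    then show ?thesis using power2_eq_1_iff[of "cmod (chi t)"] norm_ge_zero[of "chi t"] by linarith
  qed
  have formula: "\<sigma> t f z = chi t * f (act \<alpha> (- t) z)" if f: "f \<in> fock_space lam" for t f z
  proof -
    \<comment> \<open>The coherent state at \<open>u\<close> is sent to \<open>chi t\<close> times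
      the one at \<open>z\<close>; pairing with \<open>\<sigma> t f\<close> and applying the
      reproducing property at both points relates \<open>f u\<close> to
      \<open>\<sigma> t f z\<close>.\<close>
    define u where "u = act \<alpha> (- t) z"
    have z: "act \<alpha> t u = z" by (simp add: u_def act_inverse[OF \<alpha>])
    have "\<sigma> t (?\<rho> u ?one) = (\<lambda>v. chi t * ?\<rho> z ?one v)"
      using inter[OF one, of t u] bargmann_fock_scale[of lam "(z, 0)" "chi t" ?one] by (simp add: z \<sigma>_one)
    then have "gauss u * f u * K = cnj (chi t) * (gauss z * \<sigma> t f z * K)"
      using inner[OF f \<rho>one, of t u] repr[OF f, of u] repr[OF mem[OF f], of t z]
      by (auto simp: fock_inner_scale_right)
    then have "f u = cnj (chi t) * \<sigma> t f z"
      using K gauss_nz[of z] gauss_act[of t u] by (simp add: z)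
    moreover have "chi t * cnj (chi t) = 1"
      unfolding complex_norm_square[symmetric] by (simp add: norm_chi)
    ultimately show ?thesis by (simp add: u_def[symmetric] mult.assoc[symmetric])
  qed
  have "chi (s + t) = chi s * chi t" for s t
    using \<sigma>_add[OF one, of s t] scale[OF one, of s "chi t"] by (simp add: \<sigma>_one fun_eq_iff mult.commute)
  moreover have "continuous_on UNIV chi"
    unfolding continuous_on_def
  proof
    fix t
    define k where "k = fock_norm lam ?one"
    have "k \<noteq> 0" using K unfolding k_def K_def fock_norm_inner by (simp add: fock_inner_self)
    have "((\<lambda>y. fock_norm lam (\<lambda>z. \<pi> y ?one z - \<pi> (t, 0, 0) ?one z)) \<longlongrightarrow> 0) (at (t, 0, 0))"
      using rep one unfolding unitary_rep_def by blast
    \<comment> \<open>The embedding of the parameter group is injective, so it sends punctured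
      neighbourhoods of \<open>t\<close> into punctured neighbourhoods of \<open>(t, 0, 0)\<close>,
      as the limit at that point requires.\<close>
    moreover have "filterlim (\<lambda>s. (s, 0, 0)) (at (t, 0, 0)) (at t)"
      by (intro filterlim_atI tendsto_intros) (auto simp: eventually_at_filter)
    ultimately have "((\<lambda>s. fock_norm lam (\<lambda>z. \<pi> (s, 0, 0) ?one z - \<pi> (t, 0, 0) ?one z)) \<longlongrightarrow> 0) (at t)"
      by (rule filterlim_compose)
    \<comment> \<open>On the constant 1 the operators act as scalars, so norm convergence becomes
      convergence of \<open>chi\<close> up to the factor \<open>k\<close>.\<close>
    moreover have "fock_norm lam (\<lambda>z. \<pi> (s, 0, 0) ?one z - \<pi> (t, 0, 0) ?one z) = cmod (chi s - chi t) * k" for s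
      using fock_norm_scale[of lam "chi s - chi t" ?one] by (simp add: \<sigma>_\<pi>[symmetric] \<sigma>_one k_def)
    ultimately have "((\<lambda>s. cmod (chi s - chi t) * k) \<longlongrightarrow> 0) (at t)" by simp
    from tendsto_mult_right[OF this, of "1 / k"] \<open>k \<noteq> 0\<close>
    have "((\<lambda>s. cmod (chi s - chi t)) \<longlongrightarrow> 0) (at t)" by simp
    then show "(chi \<longlongrightarrow> chi t) (at t)"
      by (rule LIM_zero_cancel[OF tendsto_norm_zero_cancel])
  qed
  ultimately show ?thesis using that norm_chi formula unfolding unitary_character_def by blast
qed

theorem proposition4p1:
  fixes lam :: real
    and \<alpha> :: "'n::finite \<Rightarrow> real ^ 'm::finite \<Rightarrow> real"
    and \<sigma> :: "real ^ 'm \<Rightarrow> (complex ^ 'n \<Rightarrow> complex) \<Rightarrow> complex ^ 'n \<Rightarrow> complex"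
    and \<pi> :: "(real ^ 'm) \<times> (complex ^ 'n) \<times> real \<Rightarrow>
                 (complex ^ 'n \<Rightarrow> complex) \<Rightarrow> complex ^ 'n \<Rightarrow> complex"
  assumes "\<And>k. linear (\<alpha> k)"
    and "lam > 0"
    and "\<And>t. fock_operator lam (\<sigma> t)"
    and "\<And>t h. \<pi> (t, h) = bargmann_fock lam h \<circ> \<sigma> t"
  shows "(unitary_rep (diamond_mult \<alpha>) lam \<pi> \<longleftrightarrow>
           (\<exists>chi. unitary_character chi \<and>
             (\<forall>t. \<forall>f\<in>fock_space lam. \<forall>z. \<sigma> t f z = chi t * f (act \<alpha> (- t) z)))) \<and>
         (\<forall>chi. unitary_character chi \<and>
             (\<forall>t. \<forall>f\<in>fock_space lam. \<forall>z. \<sigma> t f z = chi t * f (act \<alpha> (- t) z)) \<longrightarrow>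
           (\<forall>t. \<forall>f\<in>fock_space lam. \<forall>z z0 c0.
             \<pi> (t, z0, c0) f z =
               chi t * exp (\<i> * complex_of_real (lam * c0)
                   + complex_of_real (lam / 2) * cdot (vcnj z0) z
                   - complex_of_real (lam / 4 * (norm z0)\<^sup>2)) * f (act \<alpha> (- t) (z - z0))))"
proof (intro conjI iffI allI impI ballI)
  assume "unitary_rep (diamond_mult \<alpha>) lam \<pi>"
  from diamond_unitary_repE[OF assms(1,2,4) this]
  show "\<exists>chi. unitary_character chi \<and>
      (\<forall>t. \<forall>f\<in>fock_space lam. \<forall>z. \<sigma> t f z = chi t * f (act \<alpha> (- t) z))"
    by metis
next
  assume "\<exists>chi. unitary_character chi \<and>
      (\<forall>t. \<forall>f\<in>fock_space lam. \<forall>z. \<sigma> t f z = chi t * f (act \<alpha> (- t) z))"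
  then obtain chi where "unitary_character chi"
    and \<sigma>: "\<And>t f z. f \<in> fock_space lam \<Longrightarrow> \<sigma> t f z = chi t * f (act \<alpha> (- t) z)" by blast
  \<comment> \<open>The pointwise formula is turned into an equation of functions, since
    \<open>bargmann_fock\<close> takes the whole function as its argument.\<close>
  moreover have "\<sigma> t f = (\<lambda>z. chi t * f (act \<alpha> (- t) z))" if "f \<in> fock_space lam" for t f
    using \<sigma>[OF that] by auto
  ultimately show "unitary_rep (diamond_mult \<alpha>) lam \<pi>"
    by (intro diamond_unitary_repI[OF assms(1)]) (auto simp: assms(4))
next
  fix chi t z z0 c0 and f :: "complex ^ 'n \<Rightarrow> complex"
  assume "unitary_character chi \<and>
      (\<forall>t. \<forall>f\<in>fock_space lam. \<forall>z. \<sigma> t f z = chi t * f (act \<alpha> (- t) z))" "f \<in> fock_space lam"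
  then show "\<pi> (t, z0, c0) f z = chi t * exp (\<i> * complex_of_real (lam * c0)
      + complex_of_real (lam / 2) * cdot (vcnj z0) z
      - complex_of_real (lam / 4 * (norm z0)\<^sup>2)) * f (act \<alpha> (- t) (z - z0))"
    by (simp add: assms(4) bargmann_fock_def)
qed

end
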